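(* (1) Let $\eta,\nu\in M_1(\mathbb{R})$. Then for any causal transport plan $\gamma\in\Pi_c(\eta,\nu)$ there exists an adapted coupling $(X,Y,(\Omega,\mathcal{A},\mathbb{P}))\in Cpl_a(\eta,\nu)$ such that $p_{X,Y}=\gamma$, where $p_{X,Y}\in M_1(\mathbb{R}\times\mathbb{R})$ denotes the joint law of $X$ and $Y$ on $(\Omega,\mathcal{A},\mathbb{P})$. (2) For any adapted coupling $(X,Y,(\Omega,\mathcal{A},\mathbb{P}))\in Cpl_a(p_X,p_Y)$, where $p_X$ (resp. $p_Y$) denotes the law of $X$ (resp. $Y$) on $(\Omega,\mathcal{A},\mathbb{P})$, one has $p_{X,Y}\in\Pi_c(p_X,p_Y)$.
   Context: $M_1(\mathbb{R})$ (resp. $M_1(\mathbb{R}\times\mathbb{R})$) is the set of Borel probability measures on $\mathbb{R}$ (resp. $\mathbb{R}\times\mathbb{R}$); $\mathcal{B}(\mathbb{R})$ is the Borel $\sigma$-field. **Adapted couplings.** Let $X,Y:\Omega\to\mathbb{R}$ be two random variables on a complete probability space $(\Omega,\mathcal{A},\mathbb{P})$. The triple $(X,Y,(\Omega,\mathcal{A},\mathbb{P}))$ is an adapted coupling if there exist two random variables $\tau:\Omega\to\mathbb{R}$ and $Z:\Omega\to\mathbb{R}$ on it such that $$Y=(X+Z)\mathbf{1}_{\{X\le\tau\}}+\tau\,\mathbf{1}_{\{X>\tau\}},\quad \mathbb{P}\text{-a.s.},$$ where: (a) $Z\ge 0$, $\mathbb{P}$-a.s.; (b) for any $t\in\mathbb{R}$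 with $\mathbb{P}(\{X\ge t\})>0$, and all Borel sets $A\subset(-\infty,t)$ and $B\subset[t,+\infty)$, $$\mathbb{P}(\{\tau\in A\}\cap\{X\in B\}\mid\{X\ge t\})=\mathbb{P}(\{\tau\in A\}\mid\{X\ge t\})\,\mathbb{P}(\{X\in B\}\mid\{X\ge t\}).$$ $Cpl_a(\eta,\nu)$ denotes the set of adapted couplings with $p_X=\eta$ and $p_Y=\nu$. **Filtration on $\mathbb{R}$.** For $t\in\mathbb{R}$, $\mathcal{B}_t(\mathbb{R})=\{A\in\mathcal{B}(\mathbb{R}): A\subset(-\infty,t)\text{ or }[t,+\infty)\subset A\}$, equivalently the $\sigma$-field generated by the sets $(-\infty,a]$, $a<t$. For a sub-$\sigma$-field $\mathcal{G}\subset\mathcal{B}(\mathbb{R})$ and $\eta\in M_1(\mathbb{R})$, $\mathcal{G}^\eta$ is the smallest $\sigma$-field containing $\mathcal{G}$ and all $\eta$-negligible sets (subsets of Borel sets of $\eta$-measure $0$). **Causal transport plans.** $\Pi(\eta,\nu)$ is the set of $\gamma\in M_1(\mathbb{R}\times\mathbb{R})$ with first marginal $\eta$ and second marginal $\nu$. For $\gamma\in\Pi(\eta,\nu)$, a transport kernel $Q_\gamma:x\mapsto Q_\gamma^x\in M_1(\mathbb{R})$ is a map such that $\phi_B:x\mapsto Q_\gamma^x(B)$ is Borel measurable for every $B\in\mathcal{B}(\mathbb{R})$ and $\gamma(A\times B)=\int_A Q_\gamma^x(B)\,\eta(dx)$ for all $A,B\in\mathcal{B}(\mathbb{R})$; it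 exists and is unique up to an $\eta$-negligible set. The filtration generated by $\gamma$ is, for $t\in\mathbb{R}$, $$\mathcal{G}_t(\gamma)=\sigma(\phi_B: B\in\mathcal{B}_t(\mathbb{R}),\ \nu(\partial B)=0)^\eta,$$ where $\partial B$ is the topological boundary. The set of causal (or adapted) transport plans is $\Pi_c(\eta,\nu)=\{\gamma\in\Pi(\eta,\nu):\mathcal{G}_t(\gamma)\subset\mathcal{B}_t(\mathbb{R})^\eta\ \ \forall t\in\mathbb{R}\}$. *)

theory Defs
  imports "HOL-Probability.Probability"
begin

abbreviation M1 :: "'a::topological_space measure set" where
  "M1 \<equiv> space (prob_algebra borel)"

definition adapted_coupling :: "'a measure \<Rightarrow> ('a \<Rightarrow> real) \<Rightarrow> ('a \<Rightarrow> real) \<Rightarrow> bool" where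
  "adapted_coupling P X Y \<longleftrightarrow>
     prob_space P \<and> complete_measure P \<and> X \<in> borel_measurable P \<and> Y \<in> borel_measurable P \<and>
     (\<exists>\<tau> \<in> borel_measurable P. \<exists>Z \<in> borel_measurable P.
        (AE \<omega> in P. Y \<omega> = (X \<omega> + Z \<omega>) * indicator {\<omega>. X \<omega> \<le> \<tau> \<omega>} \<omega>
                          + \<tau> \<omega> * indicator {\<omega>. X \<omega> > \<tau> \<omega>} \<omega>) \<and>
        (AE \<omega> in P. Z \<omega> \<ge> 0) \<and>
        (\<forall>t::real. \<P>(\<omega> in P. X \<omega> \<ge> t) > 0 \<longrightarrow>
           (\<forall>A \<in> sets borel. \<forall>B \<in> sets borel. A \<subseteq> {..<t} \<longrightarrow> B \<subseteq> {t..} \<longrightarrow>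
              \<P>(\<omega> in P. \<tau> \<omega> \<in> A \<and> X \<omega> \<in> B \<bar> X \<omega> \<ge> t) =
              \<P>(\<omega> in P. \<tau> \<omega> \<in> A \<bar> X \<omega> \<ge> t) * \<P>(\<omega> in P. X \<omega> \<in> B \<bar> X \<omega> \<ge> t))))"

definition Cpl_a ::
  "real measure \<Rightarrow> real measure \<Rightarrow> (('a \<Rightarrow> real) \<times> ('a \<Rightarrow> real) \<times> 'a measure) set" where
  "Cpl_a \<eta> \<nu> = {(X, Y, P). adapted_coupling P X Y \<and> distr P borel X = \<eta> \<and> distr P borel Y = \<nu>}"

definition borel_filtration :: "real \<Rightarrow> real set set" where
  "borel_filtration t = {A \<in> sets borel. A \<subseteq> {..<t} \<or> {t..} \<subseteq> A}"

definition null_completion :: "real measure \<Rightarrow> real set set \<Rightarrow> real set set" where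
  "null_completion \<eta> G = sigma_sets UNIV (G \<union> {N. \<exists>N' \<in> null_sets \<eta>. N \<subseteq> N'})"

definition transport_plans :: "real measure \<Rightarrow> real measure \<Rightarrow> (real \<times> real) measure set" where
  "transport_plans \<eta> \<nu> = {\<gamma> \<in> M1. distr \<gamma> borel fst = \<eta> \<and> distr \<gamma> borel snd = \<nu>}"

definition is_transport_kernel ::
  "real measure \<Rightarrow> (real \<times> real) measure \<Rightarrow> (real \<Rightarrow> real measure) \<Rightarrow> bool" where
  "is_transport_kernel \<eta> \<gamma> Q \<longleftrightarrow>
     (\<forall>x. Q x \<in> M1) \<and>
     (\<forall>B \<in> sets borel. (\<lambda>x. measure (Q x) B) \<in> borel_measurable borel) \<and>
     (\<forall>A \<in> sets borel. \<forall>B \<in> sets borel.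
        measure \<gamma> (A \<times> B) = (LINT x:A|\<eta>. measure (Q x) B))"

text \<open>A transport kernel exists and is unique up to an \<open>\<eta>\<close>-null set, so after the completion in
  \<open>plan_filtration\<close> the version picked by Hilbert choice is immaterial.\<close>

definition transport_kernel ::
  "real measure \<Rightarrow> (real \<times> real) measure \<Rightarrow> real \<Rightarrow> real measure" where
  "transport_kernel \<eta> \<gamma> = (SOME Q. is_transport_kernel \<eta> \<gamma> Q)"

definition plan_filtration ::
  "real measure \<Rightarrow> real measure \<Rightarrow> (real \<times> real) measure \<Rightarrow> real \<Rightarrow> real set set" where
  "plan_filtration \<eta> \<nu> \<gamma> t = null_completion \<eta> (sigma_sets UNIV
     {(\<lambda>x. measure (transport_kernel \<eta> \<gamma> x) B) -` C | B C.
        B \<in> borel_filtration t \<and> measure \<nu> (frontier B) = 0 \<and> C \<in> sets borel})"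

definition causal_plans :: "real measure \<Rightarrow> real measure \<Rightarrow> (real \<times> real) measure set" where
  "causal_plans \<eta> \<nu> = {\<gamma> \<in> transport_plans \<eta> \<nu>.
     \<forall>t. plan_filtration \<eta> \<nu> \<gamma> t \<subseteq> null_completion \<eta> (borel_filtration t)}"

end

theory Submission
  imports Defs
begin

text \<open>
  Let \<open>Q\<close> be the transport kernel of a plan \<open>\<gamma>\<close> with marginals \<open>\<eta>\<close> and \<open>\<nu>\<close>. The interval \<open>[t, \<infinity>)\<close> is an
  atom of the filtration at time \<open>t\<close>, so \<open>x \<mapsto> Q\<^sup>x(B)\<close> is measurable for the completed filtration if
  and only if it is almost surely constant on \<open>[t, \<infinity>)\<close>. Causality of \<open>\<gamma>\<close> therefore amounts to the
  product rule
    \<open>\<gamma>(D \<times> A) \<eta>([t, \<infinity>)) = \<eta>(D) \<gamma>([t, \<infinity>) \<times> A)\<close>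
  for all \<open>t\<close> and all Borel sets \<open>D \<subseteq> [t, \<infinity>)\<close> and \<open>A \<subseteq> (-\<infinity>, t)\<close>. In other words: given \<open>X \<ge> t\<close>, the
  event \<open>Y \<in> A\<close> is independent of \<open>X\<close>. As \<open>\<nu>\<close> has only countably many atoms, the sets with
  \<open>\<nu>\<close>-null boundary determine the rule for all Borel sets. The two implications are
  \<open>causal_plans_product_rule\<close> and \<open>causal_plansI_product_rule\<close>.

  An adapted coupling satisfies \<open>Y \<ge> X\<close> where \<open>X \<le> \<tau>\<close>, and \<open>Y = \<tau>\<close> elsewhere. On \<open>X \<ge> t\<close> the events
  \<open>Y \<in> A\<close> and \<open>\<tau> \<in> A\<close> thus agree almost surely for every \<open>A\<close> below \<open>t\<close>, and the conditional
  independence of \<open>\<tau>\<close> and \<open>X\<close> is the product rule for the joint law. Conversely, on the plane with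
  the completed measure \<open>\<gamma>\<close>, the coordinates \<open>X\<close> and \<open>Y\<close> form an adapted coupling with
  \<open>\<tau> = min X Y\<close> and \<open>Z = max 0 (Y - X)\<close>: again \<open>\<tau> \<in> A\<close> and \<open>Y \<in> A\<close> agree on \<open>X \<ge> t\<close>.

  The filtration of a plan is defined through a chosen transport kernel, so all of this needs
  a kernel to exist; \<open>transport_kernel_exists\<close> obtains one from Radon-Nikodym derivatives.
\<close>

section \<open>Existence of transport kernels\<close>

lemma transport_planD:
  assumes "\<gamma> \<in> transport_plans \<eta> \<nu>"
  shows "prob_space \<gamma>" "sets \<gamma> = sets (borel \<Otimes>\<^sub>M borel)" "space \<gamma> = UNIV"
    and "prob_space \<eta>" "sets \<eta> = sets borel" "prob_space \<nu>" "sets \<nu> = sets borel"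
    and "\<And>A B. A \<in> sets borel \<Longrightarrow> B \<in> sets borel \<Longrightarrow> A \<times> B \<in> sets \<gamma>"
proof -
  from assms show G: "prob_space \<gamma>" and sets_G: "sets \<gamma> = sets (borel \<Otimes>\<^sub>M borel)"
    unfolding borel_prod by (auto simp: transport_plans_def space_prob_algebra)
  from sets_G have [measurable_cong]: "sets \<gamma> = sets (borel \<Otimes>\<^sub>M borel)" .
  from assms have eta: "\<eta> = distr \<gamma> borel fst" and nu: "\<nu> = distr \<gamma> borel snd"
    by (auto simp: transport_plans_def)
  show "space \<gamma> = UNIV" using sets_eq_imp_space_eq[OF sets_G] by (simp add: space_pair_measure)
  show "prob_space \<eta>" unfolding eta by (rule prob_space.prob_space_distr[OF G]) measurable
  show "prob_space \<nu>" unfolding nu by (rule prob_space.prob_space_distr[OF G]) measurable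
  show "sets \<eta> = sets borel" "sets \<nu> = sets borel" by (simp_all add: eta nu)
  show "A \<times> B \<in> sets \<gamma>" if "A \<in> sets borel" "B \<in> sets borel" for A B
    unfolding sets_G using that by (rule pair_measureI)
qed

lemma measure_Times_UNIV_eq_marginal:
  assumes \<gamma>: "\<gamma> \<in> transport_plans \<eta> \<nu>" and A: "A \<in> sets borel"
  shows "measure \<gamma> (A \<times> UNIV) = measure \<eta> A"
proof -
  note [measurable_cong] = transport_planD(2)[OF \<gamma>]
  from \<gamma> have eta: "\<eta> = distr \<gamma> borel fst" by (simp add: transport_plans_def)
  show ?thesis
    unfolding eta using A
    by (subst measure_distr) (auto simp: fst_vimage_eq_Times transport_planD(3)[OF \<gamma>])
qed

text \<open>Testing against the set where \<open>g < f\<close> makes the integral of \<open>f - g\<close> over that set vanish;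
  the finite integral of \<open>g\<close> is what allows the two integrals to be subtracted.\<close>

lemma AE_le_if_nn_integral_le:
  fixes f g :: "'a \<Rightarrow> ennreal"
  assumes f[measurable]: "f \<in> borel_measurable M" and g[measurable]: "g \<in> borel_measurable M"
    and fin: "(\<integral>\<^sup>+x. g x \<partial>M) \<noteq> \<infinity>"
    and le: "\<And>A. A \<in> sets M \<Longrightarrow> (\<integral>\<^sup>+x. f x * indicator A x \<partial>M) \<le> (\<integral>\<^sup>+x. g x * indicator A x \<partial>M)"
  shows "AE x in M. f x \<le> g x"
proof -
  define A where "A = {x \<in> space M. g x < f x}"
  have A[measurable]: "A \<in> sets M" unfolding A_def by measurable
  have "(\<integral>\<^sup>+x. g x * indicator A x \<partial>M) \<le> (\<integral>\<^sup>+x. g x \<partial>M)"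
    by (intro nn_integral_mono) (auto split: split_indicator)
  then have finA: "(\<integral>\<^sup>+x. g x * indicator A x \<partial>M) \<noteq> \<infinity>"
    using fin by (auto simp: top_unique)
  have "(\<integral>\<^sup>+x. f x * indicator A x - g x * indicator A x \<partial>M)
      = (\<integral>\<^sup>+x. f x * indicator A x \<partial>M) - (\<integral>\<^sup>+x. g x * indicator A x \<partial>M)"
    by (intro nn_integral_diff finA) (auto simp: A_def split: split_indicator)
  also have "\<dots> = 0"
    using le[OF A] finA by (auto simp: diff_eq_0_iff_ennreal less_top[symmetric] top_unique)
  finally have "AE x in M. f x * indicator A x - g x * indicator A x = 0"
    by (subst (asm) nn_integral_0_iff_AE) auto
  then show ?thesis
    by (rule AE_mp) (auto intro!: AE_I2 simp: A_def diff_eq_0_iff_ennreal not_less[symmetric] split: split_indicator_asm)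
qed

text \<open>The function is the Radon-Nikodym derivative of \<open>A \<mapsto> \<gamma> (A \<times> B)\<close> with respect to the first
  marginal, which dominates that measure. Since the derivative is at most one almost everywhere, it
  can be truncated so that the bounds hold at every point; later infima and suprema over the
  rationals are then bounded without exceptions.\<close>

lemma conditional_probability_given_fst:
  fixes \<gamma> :: "(real \<times> real) measure"
  assumes "prob_space \<gamma>" and sets: "sets \<gamma> = sets borel" and B: "B \<in> sets borel"
  shows "\<exists>g. g \<in> borel_measurable borel \<and> (\<forall>x. 0 \<le> g x \<and> g x \<le> (1::real)) \<and>
    (\<forall>A\<in>sets borel.
       (\<integral>\<^sup>+x. ennreal (g x) * indicator A x \<partial>distr \<gamma> borel fst) = emeasure \<gamma> (A \<times> B))"
proof -
  interpret G: prob_space \<gamma> by fact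
  have sets_prod[measurable_cong]: "sets \<gamma> = sets (borel \<Otimes>\<^sub>M borel)"
    unfolding sets borel_prod ..
  note B[measurable]
  define \<eta> where "\<eta> = distr \<gamma> borel fst"
  interpret E: prob_space \<eta>
    unfolding \<eta>_def by (rule G.prob_space_distr) measurable
  have space_G: "space \<gamma> = UNIV" using sets_eq_imp_space_eq[OF sets] by simp
  have sets_eta[simp, measurable_cong]: "sets \<eta> = sets borel" by (simp add: \<eta>_def)
  define N where "N = distr (density \<gamma> (indicator (UNIV \<times> B))) borel fst"
  have N: "emeasure N A = emeasure \<gamma> (A \<times> B)" if [measurable]: "A \<in> sets borel" for A
  proof -
    have "emeasure N A = emeasure (density \<gamma> (indicator (UNIV \<times> B))) (A \<times> UNIV)"
      unfolding N_def by (subst emeasure_distr) (auto simp: space_G fst_vimage_eq_Times)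
    also have "\<dots> = (\<integral>\<^sup>+z. indicator (UNIV \<times> B) z * indicator (A \<times> UNIV) z \<partial>\<gamma>)"
      by (rule emeasure_density) auto
    also have "\<dots> = (\<integral>\<^sup>+z. indicator (A \<times> B) z \<partial>\<gamma>)"
      by (intro nn_integral_cong) (auto split: split_indicator)
    finally have "emeasure N A = (\<integral>\<^sup>+z. indicator (A \<times> B) z \<partial>\<gamma>)" .
    then show ?thesis by simp
  qed
  have le: "emeasure N A \<le> emeasure \<eta> A" if [measurable]: "A \<in> sets borel" for A
    unfolding N[OF that] \<eta>_def
    by (subst emeasure_distr, measurable) (auto intro!: emeasure_mono simp: space_G fst_vimage_eq_Times)
  have ac: "absolutely_continuous \<eta> N"
    unfolding absolutely_continuous_def null_sets_def
    using le by (auto simp: N_def) (metis le_zero_eq)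
  define h where "h = RN_deriv \<eta> N"
  have h[measurable]: "h \<in> borel_measurable borel"
    unfolding h_def using borel_measurable_RN_deriv[of \<eta> N] by simp
  have h_int: "(\<integral>\<^sup>+x. h x * indicator A x \<partial>\<eta>) = emeasure \<gamma> (A \<times> B)" if [measurable]: "A \<in> sets borel" for A
  proof -
    have "density \<eta> h = N"
      unfolding h_def by (intro E.density_RN_deriv ac) (simp add: N_def)
    then show ?thesis
      using N[OF that] by (subst emeasure_density[symmetric]) auto
  qed
  have "AE x in \<eta>. h x \<le> 1"
  proof (rule AE_le_if_nn_integral_le)
    show "(\<integral>\<^sup>+x. h x * indicator A x \<partial>\<eta>) \<le> (\<integral>\<^sup>+x. 1 * indicator A x \<partial>\<eta>)" if "A \<in> sets \<eta>" for A
      using le[of A] h_int[of A] N[of A] that by simp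
  qed (auto simp: E.emeasure_space_1)
  define g where "g x = enn2real (min 1 (h x))" for x
  have g_AE: "AE x in \<eta>. ennreal (g x) = h x"
    using \<open>AE x in \<eta>. h x \<le> 1\<close>
    by eventually_elim (auto simp: g_def min_def ennreal_enn2real_if top_unique)
  show ?thesis
  proof (intro exI[of _ g] conjI allI ballI)
    show "g \<in> borel_measurable borel" unfolding g_def by measurable
    show "0 \<le> g x" for x by (simp add: g_def)
    show "g x \<le> 1" for x
      unfolding g_def by (rule enn2real_leI) auto
    show "(\<integral>\<^sup>+x. ennreal (g x) * indicator A x \<partial>distr \<gamma> borel fst) = emeasure \<gamma> (A \<times> B)"
      if "A \<in> sets borel" for A
      unfolding h_int[OF that, symmetric] \<eta>_def[symmetric]
      using g_AE by (intro nn_integral_cong_AE) auto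
  qed
qed

text \<open>A distribution function is determined by its values on the rationals, and only countably many
  almost sure relations can be arranged at once, so kernels are built from such values. The function
  \<open>h\<close> need not be right-continuous along the rationals; taking the infimum over the rationals
  strictly above a point forces right-continuity and keeps the limits at both ends.\<close>

lemma real_distribution_of_rational_cdf:
  fixes h :: "rat \<Rightarrow> real"
  assumes mono: "\<And>q r. q \<le> r \<Longrightarrow> h q \<le> h r" and nonneg: "\<And>q. 0 \<le> h q" and le_1: "\<And>q. h q \<le> 1"
    and bot: "(INF q. h q) = 0" and top: "(SUP q. h q) = 1"
  defines "F \<equiv> \<lambda>y. INF q\<in>{q. y < of_rat q}. h q"
  shows "real_distribution (interval_measure F)" "cdf (interval_measure F) = F"
proof -
  have bdd: "bdd_below (h ` S)" for S using nonneg by (auto intro!: bdd_belowI)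
  have ne: "{q. y < real_of_rat q} \<noteq> {}" for y
    using of_rat_dense[of y "y + 1"] by auto
  have F_le: "F y \<le> h q" if "y < of_rat q" for y q
    unfolding F_def using that by (intro cINF_lower bdd) auto
  have F_ge: "c \<le> F y" if "\<And>q. y < of_rat q \<Longrightarrow> c \<le> h q" for y c
    unfolding F_def using that by (intro cINF_greatest ne) auto
  have F_less: "\<exists>q. y < of_rat q \<and> h q < c" if "F y < c" for y c
    using that F_ge[of y c] by (meson not_le)
  have F_mono: "F x \<le> F y" if "x \<le> y" for x y
    using that by (intro F_ge F_le) auto
  have rc: "continuous (at_right a) F" for a
  proof (subst continuous_at_right_real_increasing, rule F_mono, assumption, intro allI impI)
    fix e :: real assume "0 < e"
    then obtain q where q: "a < of_rat q" "h q < F a + e" using F_less[of a "F a + e"] by auto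
    then have "F (a + (of_rat q - a) / 2) \<le> h q" by (intro F_le) (simp add: field_simps)
    with q show "\<exists>d>0. F (a + d) - F a < e"
      by (intro exI[of _ "(of_rat q - a) / 2"]) auto
  qed
  have at_bot: "(F \<longlongrightarrow> 0) at_bot"
  proof (rule order_tendstoI)
    fix c :: real assume "0 < c"
    then have "(INF q. h q) < c" by (simp add: bot)
    then obtain q where "h q < c" by (auto simp: cINF_less_iff[OF _ bdd])
    then show "\<forall>\<^sub>F y in at_bot. F y < c"
      using F_le[of _ q] by (intro eventually_mono[OF eventually_gt_at_bot[of "of_rat q"]]) (meson le_less_trans)
  next
    fix c :: real assume "c < 0"
    then show "\<forall>\<^sub>F y in at_bot. c < F y"
      using F_ge[of _ 0] nonneg by (intro always_eventually allI) (meson less_le_trans)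
  qed
  have at_top: "(F \<longlongrightarrow> 1) at_top"
  proof (rule order_tendstoI)
    fix c :: real assume "c < 1"
    then have "c < (SUP q. h q)" by (simp add: top)
    moreover have "bdd_above (range h)" using le_1 by (auto intro!: bdd_aboveI)
    ultimately obtain q where q: "c < h q" by (auto simp: less_cSUP_iff)
    have "c < F y" if "of_rat q \<le> y" for y
    proof -
      have "h q \<le> F y" using that by (intro F_ge mono) (metis le_less_trans less_imp_le of_rat_less)
      with q show ?thesis by simp
    qed
    then show "\<forall>\<^sub>F y in at_top. c < F y"
      by (rule eventually_mono[OF eventually_ge_at_top[of "of_rat q"]])
  next
    fix c :: real assume "1 < c"
    have "F y \<le> 1" for y
      using ne[of y] F_le[of y] le_1 by (auto intro: order_trans)
    with \<open>1 < c\<close> show "\<forall>\<^sub>F y in at_top. F y < c"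
      by (intro always_eventually allI) (meson le_less_trans)
  qed
  show "real_distribution (interval_measure F)" "cdf (interval_measure F) = F"
    by (intro real_distribution_interval_measure cdf_interval_measure F_mono rc at_bot at_top; assumption)+
qed

text \<open>This is the disintegration of \<open>\<gamma>\<close> over its first marginal. Conditional probabilities of the
  half-lines with rational endpoint are monotone and have the limits zero and one outside a single
  null set. There they define a distribution function, whose measure is the kernel; on the null
  set the kernel is the Dirac mass at zero. Half-lines form a generator that is stable under
  intersection, so measurability and the integral formula pass from them to all Borel sets.\<close>

lemma transport_kernel_exists:
  assumes "\<gamma> \<in> transport_plans \<eta> \<nu>"
  shows "\<exists>Q. is_transport_kernel \<eta> \<gamma> Q"
proof -
  note plan = transport_planD[OF assms]
  note space_G = plan(3)
  note sets_prod[measurable_cong] = plan(2)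
  note sets_eta[simp, measurable_cong] = plan(5)
  note rect[measurable] = plan(8)
  have sets_G: "sets \<gamma> = sets borel" unfolding plan(2) borel_prod ..
  have eta: "\<eta> = distr \<gamma> borel fst" using assms by (simp add: transport_plans_def)
  interpret G: prob_space \<gamma> by (rule plan(1))
  interpret E: prob_space \<eta> by (rule plan(4))
  have "\<forall>B\<in>sets borel. \<exists>g. g \<in> borel_measurable borel \<and> (\<forall>x::real. 0 \<le> g x \<and> g x \<le> (1::real)) \<and>
      (\<forall>A\<in>sets borel. (\<integral>\<^sup>+x. ennreal (g x) * indicator A x \<partial>\<eta>) = emeasure \<gamma> (A \<times> B))"
    using conditional_probability_given_fst[OF plan(1) sets_G, folded eta] ..
  from bchoice[OF this] obtain g :: "real set \<Rightarrow> real \<Rightarrow> real" where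
    g: "\<forall>B\<in>sets borel. g B \<in> borel_measurable borel \<and> (\<forall>x. 0 \<le> g B x \<and> g B x \<le> 1) \<and>
      (\<forall>A\<in>sets borel. (\<integral>\<^sup>+x. ennreal (g B x) * indicator A x \<partial>\<eta>) = emeasure \<gamma> (A \<times> B))" ..
  have g_meas: "g B \<in> borel_measurable borel" and g_range: "0 \<le> g B x \<and> g B x \<le> 1"
    if "B \<in> sets borel" for B x
    using g that by auto
  have g_int: "(\<integral>\<^sup>+x. ennreal (g B x) * indicator A x \<partial>\<eta>) = emeasure \<gamma> (A \<times> B)"
    if "A \<in> sets borel" "B \<in> sets borel" for A B
    using g that by auto
  have g_mono: "AE x in \<eta>. g B x \<le> g B' x" if B: "B \<in> sets borel" "B' \<in> sets borel" "B \<subseteq> B'" for B B'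
  proof -
    note [measurable] = B(1,2) g_meas[OF B(1)] g_meas[OF B(2)]
    have "AE x in \<eta>. ennreal (g B x) \<le> ennreal (g B' x)"
    proof (rule AE_le_if_nn_integral_le)
      show "(\<integral>\<^sup>+x. ennreal (g B' x) \<partial>\<eta>) \<noteq> \<infinity>"
        using g_int[of UNIV B'] B by simp
      show "(\<integral>\<^sup>+x. ennreal (g B x) * indicator A x \<partial>\<eta>) \<le> (\<integral>\<^sup>+x. ennreal (g B' x) * indicator A x \<partial>\<eta>)"
        if [measurable]: "A \<in> sets \<eta>" for A
        using that B by (subst (1 2) g_int) (auto intro!: emeasure_mono rect)
    qed auto
    then show ?thesis using g_range B by (auto simp: ennreal_le_iff)
  qed
  \<comment> \<open>A version of the conditional distribution function at rational points.\<close>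
  define h where "h x q = g {..of_rat q} x" for x and q :: rat
  have h_meas[measurable]: "(\<lambda>x. h x q) \<in> borel_measurable borel" for q
    unfolding h_def by (intro g_meas) simp
  have h_nonneg[simp]: "0 \<le> h x q" and h_le_1[simp]: "h x q \<le> 1" for x q
    unfolding h_def using g_range by auto
  have h_int: "(\<integral>\<^sup>+x. ennreal (h x q) * indicator A x \<partial>\<eta>) = emeasure \<gamma> (A \<times> {..of_rat q})"
    if "A \<in> sets borel" for A q
    unfolding h_def using that by (intro g_int) auto
  have bdd: "bdd_below (h x ` S)" "bdd_above (h x ` S)" for x S
    by (auto intro!: bdd_belowI[of _ 0] bdd_aboveI[of _ 1])
  have lim_bot: "(\<lambda>n. measure \<gamma> (UNIV \<times> {..- real n})) \<longlonglongrightarrow> 0"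
  proof -
    have "(\<lambda>n. measure \<gamma> (UNIV \<times> {..- real n})) \<longlonglongrightarrow> measure \<gamma> (\<Inter>n. UNIV \<times> {..- real n})"
      by (intro G.finite_Lim_measure_decseq) (auto simp: decseq_def)
    also have "(\<Inter>n. UNIV \<times> {..- real n}) = ({} :: (real \<times> real) set)"
    proof -
      have "\<exists>n. \<not> y \<le> - real n" for y
        using reals_Archimedean2[of "- y"] by (auto simp: not_le minus_less_iff)
      then show ?thesis by auto
    qed
    finally show ?thesis by simp
  qed
  have lim_top: "(\<lambda>n. measure \<gamma> (UNIV \<times> {..real n})) \<longlonglongrightarrow> 1"
  proof -
    have "(\<lambda>n. measure \<gamma> (UNIV \<times> {..real n})) \<longlonglongrightarrow> measure \<gamma> (\<Union>n. UNIV \<times> {..real n})"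
      by (intro G.finite_Lim_measure_incseq) (auto simp: incseq_def)
    also have "(\<Union>n. UNIV \<times> {..real n}) = (UNIV :: (real \<times> real) set)"
      by (auto simp: real_arch_simple)
    finally show ?thesis using G.prob_space by (simp add: space_G)
  qed
  have [measurable]: "(\<lambda>x. SUP q. h x q) \<in> borel_measurable borel"
    by (intro borel_measurable_cSUP bdd) auto
  have AE_bot: "AE x in \<eta>. (INF q. h x q) = 0"
  proof -
    have "(\<integral>\<^sup>+x. ennreal (INF q. h x q) \<partial>\<eta>) \<le> ennreal (measure \<gamma> (UNIV \<times> {..- real n}))" for n
    proof -
      have "(\<integral>\<^sup>+x. ennreal (INF q. h x q) \<partial>\<eta>) \<le> (\<integral>\<^sup>+x. ennreal (h x (- of_nat n)) * indicator UNIV x \<partial>\<eta>)"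
        by (intro nn_integral_mono) (auto intro!: ennreal_leI cINF_lower bdd)
      also have "\<dots> = ennreal (measure \<gamma> (UNIV \<times> {..- real n}))"
        by (subst h_int) (auto simp: G.emeasure_eq_measure of_rat_minus)
      finally show ?thesis .
    qed
    then have "(\<integral>\<^sup>+x. ennreal (INF q. h x q) \<partial>\<eta>) \<le> ennreal 0"
      by (intro LIMSEQ_le_const[OF tendsto_ennrealI[OF lim_bot]]) auto
    then have "AE x in \<eta>. ennreal (INF q. h x q) = 0"
      by (subst nn_integral_0_iff_AE[symmetric]) auto
    then show ?thesis
    proof eventually_elim
      case (elim x)
      have "0 \<le> (INF q. h x q)" by (intro cINF_greatest) auto
      with elim show ?case by (auto simp: ennreal_eq_0_iff)
    qed
  qed
  have AE_top: "AE x in \<eta>. (SUP q. h x q) = 1"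
  proof -
    have SUP_le: "(SUP q. h x q) \<le> 1" for x by (intro cSUP_least) auto
    have "(\<integral>\<^sup>+x. ennreal (1 - (SUP q. h x q)) \<partial>\<eta>) \<le> ennreal (1 - measure \<gamma> (UNIV \<times> {..real n}))" for n
    proof -
      have "(\<integral>\<^sup>+x. ennreal (1 - (SUP q. h x q)) \<partial>\<eta>) \<le> (\<integral>\<^sup>+x. 1 - ennreal (h x (of_nat n)) \<partial>\<eta>)"
        by (intro nn_integral_mono)
          (auto intro!: cSUP_upper bdd ennreal_leI simp: ennreal_1[symmetric] ennreal_minus simp del: ennreal_1)
      also have "\<dots> = 1 - (\<integral>\<^sup>+x. ennreal (h x (of_nat n)) \<partial>\<eta>)"
        using h_int[of UNIV "of_nat n"]
        by (subst nn_integral_diff) (auto simp: E.emeasure_space_1 ennreal_le_1)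
      also have "(\<integral>\<^sup>+x. ennreal (h x (of_nat n)) \<partial>\<eta>) = ennreal (measure \<gamma> (UNIV \<times> {..real n}))"
        using h_int[of UNIV "of_nat n"] by (simp add: G.emeasure_eq_measure)
      finally show ?thesis by (simp add: ennreal_1[symmetric] ennreal_minus del: ennreal_1)
    qed
    then have "(\<integral>\<^sup>+x. ennreal (1 - (SUP q. h x q)) \<partial>\<eta>) \<le> ennreal (1 - 1)"
      by (intro LIMSEQ_le_const[OF tendsto_ennrealI[OF tendsto_diff[OF tendsto_const lim_top]]]) auto
    then have "AE x in \<eta>. ennreal (1 - (SUP q. h x q)) = 0"
      by (subst nn_integral_0_iff_AE[symmetric]) auto
    then show ?thesis
      by eventually_elim (use SUP_le in \<open>auto simp: ennreal_eq_0_iff intro: antisym\<close>)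
  qed
  have AE_mono: "AE x in \<eta>. \<forall>q r. q \<le> r \<longrightarrow> h x q \<le> h x r"
    unfolding AE_all_countable
  proof (intro allI)
    fix q r :: rat show "AE x in \<eta>. q \<le> r \<longrightarrow> h x q \<le> h x r"
      using g_mono[of "{..of_rat q}" "{..of_rat r}"] unfolding h_def
      by (cases "q \<le> r") (auto simp: of_rat_less_eq)
  qed
  \<comment> \<open>The points at which the rational values extend to a distribution function.\<close>
  define good where
    "good x \<longleftrightarrow> (\<forall>q r. q \<le> r \<longrightarrow> h x q \<le> h x r) \<and> (INF q. h x q) = 0 \<and> (SUP q. h x q) = 1" for x
  have good_meas[measurable]: "Measurable.pred borel good"
    unfolding good_def by measurable
  have AE_good: "AE x in \<eta>. good x"
    using AE_mono AE_bot AE_top by eventually_elim (auto simp: good_def)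
  define F where "F x y = (INF q\<in>{q. y < of_rat q}. h x q)" for x y :: real
  have F_meas[measurable]: "(\<lambda>x. F x y) \<in> borel_measurable borel" for y
    unfolding F_def by measurable
  define Q where "Q x = (if good x then interval_measure (F x) else return borel 0)" for x
  have Q_good: "real_distribution (interval_measure (F x))" "cdf (interval_measure (F x)) = F x" if "good x" for x
    using real_distribution_of_rational_cdf[of "h x"] that unfolding good_def F_def by auto
  have Q_prob: "prob_space (Q x)" for x
    using Q_good(1)[of x] by (auto simp: Q_def real_distribution_def prob_space_return)
  have Q_sets[simp]: "sets (Q x) = sets borel" for x by (simp add: Q_def)
  have Q_half_line: "emeasure (Q x) {..y} = (if good x then ennreal (F x y) else indicator {..y} 0)" for x y
  proof -
    interpret prob_space "Q x" by (rule Q_prob)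
    show ?thesis
      using Q_good(2)[of x] emeasure_eq_measure[of "{..y}"]
      by (auto simp: Q_def cdf_def fun_eq_iff)
  qed
  have Q_meas[measurable]: "Q \<in> borel \<rightarrow>\<^sub>M prob_algebra borel"
  proof (rule measurable_prob_algebra_generated)
    show "sets borel = sigma_sets UNIV (range (\<lambda>a::real. {..a}))"
      by (subst borel_eq_atMost) simp
    show "Int_stable (range (\<lambda>a::real. {..a}))"
      by (auto simp: Int_stable_def)
    show "(\<lambda>x. emeasure (Q x) A) \<in> borel_measurable borel" if "A \<in> range (\<lambda>a::real. {..a})" for A
      using that by (auto simp: Q_half_line)
  qed (auto simp: Q_prob)
  have Q_emeas[measurable]: "(\<lambda>x. emeasure (Q x) B) \<in> borel_measurable borel" if "B \<in> sets borel" for B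
    by (rule measurable_compose[OF measurable_prob_algebraD[OF Q_meas] measurable_emeasure_subprob_algebra[OF that]])
  have F_int: "(\<integral>\<^sup>+x. ennreal (F x y) * indicator A x \<partial>\<eta>) = emeasure \<gamma> (A \<times> {..y})"
    if A[measurable]: "A \<in> sets borel" for A y
  proof (rule antisym)
    have ne: "{q. y < real_of_rat q} \<noteq> {}"
      using of_rat_dense[of y "y + 1"] by auto
    \<comment> \<open>The bound from above uses rationals between \<open>y\<close> and \<open>y + 1 / (n + 1)\<close>; the bound from below
      compares with the density of \<open>{..y}\<close> itself, which lies below all rational values.\<close>
    define a where "a n = y + 1 / Suc n" for n
    have a_antimono: "a n \<le> a m" if "m \<le> n" for m n
      unfolding a_def using that by (intro add_left_mono divide_left_mono) auto
    have "\<exists>q. y < of_rat q \<and> of_rat q < a n" for n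
      unfolding a_def by (rule of_rat_dense) auto
    then obtain q where q: "\<And>n. y < of_rat (q n)" "\<And>n. of_rat (q n) < a n" by metis
    have "(\<integral>\<^sup>+x. ennreal (F x y) * indicator A x \<partial>\<eta>) \<le> ennreal (measure \<gamma> (A \<times> {..a n}))" for n
    proof -
      have "(\<integral>\<^sup>+x. ennreal (F x y) * indicator A x \<partial>\<eta>)
          \<le> (\<integral>\<^sup>+x. ennreal (h x (q n)) * indicator A x \<partial>\<eta>)"
        unfolding F_def using q
        by (intro nn_integral_mono mult_right_mono ennreal_leI cINF_lower bdd) auto
      also have "\<dots> \<le> emeasure \<gamma> (A \<times> {..a n})"
        using q(2)[of n] by (subst h_int) (auto intro!: emeasure_mono rect)
      finally show ?thesis by (simp add: G.emeasure_eq_measure)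
    qed
    moreover have "(\<lambda>n. measure \<gamma> (A \<times> {..a n})) \<longlonglongrightarrow> measure \<gamma> (A \<times> {..y})"
    proof -
      have "(\<lambda>n. measure \<gamma> (A \<times> {..a n})) \<longlonglongrightarrow> measure \<gamma> (\<Inter>n. A \<times> {..a n})"
        by (intro G.finite_Lim_measure_decseq)
          (use a_antimono in \<open>auto simp: decseq_def intro: order_trans\<close>)
      also have "(\<Inter>n. A \<times> {..a n}) = A \<times> {..y}"
      proof -
        have "z \<le> y" if "\<forall>n. z \<le> a n" for z
        proof (rule LIMSEQ_le_const)
          show "a \<longlonglongrightarrow> y"
            unfolding a_def using tendsto_add[OF tendsto_const LIMSEQ_inverse_real_of_nat, of y]
            by (simp add: inverse_eq_divide)
        qed (use that in auto)
        moreover have "y \<le> a n" for n by (simp add: a_def)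
        ultimately show ?thesis by (auto intro: order_trans)
      qed
      finally show ?thesis .
    qed
    ultimately have "(\<integral>\<^sup>+x. ennreal (F x y) * indicator A x \<partial>\<eta>) \<le> ennreal (measure \<gamma> (A \<times> {..y}))"
      by (intro LIMSEQ_le_const[OF tendsto_ennrealI]) auto
    then show "(\<integral>\<^sup>+x. ennreal (F x y) * indicator A x \<partial>\<eta>) \<le> emeasure \<gamma> (A \<times> {..y})"
      by (simp add: G.emeasure_eq_measure)
    have "AE x in \<eta>. \<forall>q. y < of_rat q \<longrightarrow> g {..y} x \<le> h x q"
      unfolding AE_all_countable
    proof (intro allI)
      fix q show "AE x in \<eta>. y < of_rat q \<longrightarrow> g {..y} x \<le> h x q"
        using g_mono[of "{..y}" "{..of_rat q}"] unfolding h_def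
        by (cases "y < of_rat q") auto
    qed
    then have "AE x in \<eta>. g {..y} x \<le> F x y"
      unfolding F_def by eventually_elim (intro cINF_greatest ne, auto)
    then have "(\<integral>\<^sup>+x. ennreal (g {..y} x) * indicator A x \<partial>\<eta>) \<le> (\<integral>\<^sup>+x. ennreal (F x y) * indicator A x \<partial>\<eta>)"
      by (intro nn_integral_mono_AE) (auto intro!: mult_right_mono ennreal_leI)
    then show "emeasure \<gamma> (A \<times> {..y}) \<le> (\<integral>\<^sup>+x. ennreal (F x y) * indicator A x \<partial>\<eta>)"
      using g_int[of A "{..y}"] by simp
  qed
  have Q_int: "emeasure \<gamma> (A \<times> B) = (\<integral>\<^sup>+x. emeasure (Q x) B * indicator A x \<partial>\<eta>)"
    if A[measurable]: "A \<in> sets borel" and B: "B \<in> sets borel" for A B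
  proof -
    have "Int_stable (range (\<lambda>a::real. {..a}))" "range (\<lambda>a::real. {..a}) \<subseteq> Pow UNIV"
      by (auto simp: Int_stable_def)
    moreover have "B \<in> sigma_sets UNIV (range (\<lambda>a::real. {..a}))"
      using B by (subst (asm) borel_eq_atMost) simp
    ultimately show ?thesis
    proof (induction rule: sigma_sets_induct_disjoint)
      case (basic B)
      then obtain y where "B = {..y}" by auto
      have "(\<integral>\<^sup>+x. emeasure (Q x) {..y} * indicator A x \<partial>\<eta>) = (\<integral>\<^sup>+x. ennreal (F x y) * indicator A x \<partial>\<eta>)"
        using AE_good by (intro nn_integral_cong_AE) (auto simp: Q_half_line)
      with F_int[OF A] show ?case by (simp add: \<open>B = {..y}\<close>)
    next
      case empty then show ?case by simp
    next
      case (compl B)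
      then have [measurable]: "B \<in> sets borel" by (subst borel_eq_atMost) simp
      have QB: "emeasure (Q x) (UNIV - B) = 1 - emeasure (Q x) B" for x
      proof -
        interpret prob_space "Q x" by (rule Q_prob)
        have "space (Q x) = UNIV" using sets_eq_imp_space_eq[OF Q_sets] by simp
        then show ?thesis using emeasure_compl[of B "Q x"] emeasure_space_1 by simp
      qed
      have "A \<times> (UNIV - B) = A \<times> UNIV - A \<times> B" by auto
      then have "emeasure \<gamma> (A \<times> (UNIV - B)) = emeasure \<gamma> (A \<times> UNIV) - emeasure \<gamma> (A \<times> B)"
        by (simp only:) (intro emeasure_Diff, auto intro!: rect)
      also have "emeasure \<gamma> (A \<times> UNIV) = emeasure \<eta> A"
        using measure_Times_UNIV_eq_marginal[OF assms A] by (simp add: G.emeasure_eq_measure E.emeasure_eq_measure)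
      also have "emeasure \<eta> A - emeasure \<gamma> (A \<times> B) = (\<integral>\<^sup>+x. indicator A x - emeasure (Q x) B * indicator A x \<partial>\<eta>)"
      proof (subst nn_integral_diff)
        show "(\<integral>\<^sup>+x. emeasure (Q x) B * indicator A x \<partial>\<eta>) \<noteq> \<infinity>"
          using compl(2) by (metis G.emeasure_finite infinity_ennreal_def)
        show "AE x in \<eta>. emeasure (Q x) B * indicator A x \<le> indicator A x"
          using Q_prob by (auto intro!: AE_I2 split: split_indicator simp: prob_space.measure_le_1)
      qed (use compl(2) in auto)
      also have "\<dots> = (\<integral>\<^sup>+x. emeasure (Q x) (UNIV - B) * indicator A x \<partial>\<eta>)"
        by (intro nn_integral_cong) (auto simp: QB split: split_indicator)
      finally show ?case .
    next
      case (union B)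
      then have [measurable]: "\<And>i. B i \<in> sets borel" by (subst borel_eq_atMost) (auto simp: image_subset_iff)
      have "A \<times> (\<Union>i. B i) = (\<Union>i. A \<times> B i)" by auto
      then have "emeasure \<gamma> (A \<times> (\<Union>i. B i)) = (\<Sum>i. emeasure \<gamma> (A \<times> B i))"
        using union(1) by (simp only:) (intro suminf_emeasure[symmetric],
          auto intro!: rect simp: disjoint_family_on_def)
      also have "\<dots> = (\<integral>\<^sup>+x. (\<Sum>i. emeasure (Q x) (B i) * indicator A x) \<partial>\<eta>)"
        using union by (subst nn_integral_suminf) auto
      also have "\<dots> = (\<integral>\<^sup>+x. emeasure (Q x) (\<Union>i. B i) * indicator A x \<partial>\<eta>)"
        using union(1) by (intro nn_integral_cong) (simp add: suminf_emeasure image_subset_iff)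
      finally show ?case .
    qed
  qed
  have "is_transport_kernel \<eta> \<gamma> Q"
    unfolding is_transport_kernel_def
  proof (intro conjI allI ballI)
    show "Q x \<in> M1" for x by (simp add: space_prob_algebra Q_prob)
    show [measurable]: "(\<lambda>x. measure (Q x) B) \<in> borel_measurable borel" if [measurable]: "B \<in> sets borel" for B
      unfolding measure_def by measurable
    fix A B :: "real set" assume [measurable]: "A \<in> sets borel" "B \<in> sets borel"
    have "(LINT x:A|\<eta>. measure (Q x) B) = enn2real (\<integral>\<^sup>+x. ennreal (indicator A x * measure (Q x) B) \<partial>\<eta>)"
      unfolding set_lebesgue_integral_def by (subst integral_eq_nn_integral) auto
    also have "(\<integral>\<^sup>+x. ennreal (indicator A x * measure (Q x) B) \<partial>\<eta>) = (\<integral>\<^sup>+x. emeasure (Q x) B * indicator A x \<partial>\<eta>)"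
    proof (intro nn_integral_cong)
      fix x
      interpret prob_space "Q x" by (rule Q_prob)
      show "ennreal (indicator A x * measure (Q x) B) = emeasure (Q x) B * indicator A x"
        by (auto simp: emeasure_eq_measure split: split_indicator)
    qed
    also have "\<dots> = emeasure \<gamma> (A \<times> B)" by (simp add: Q_int)
    finally show "measure \<gamma> (A \<times> B) = (LINT x:A|\<eta>. measure (Q x) B)" by (simp add: measure_def)
  qed
  then show ?thesis by (intro exI[of _ Q])
qed

section \<open>Causality as a product rule\<close>

text \<open>A random variable with a trivial generated \<open>\<sigma>\<close>-field is constant: if it were below its
  mean with positive probability, it would be so almost surely, which the mean itself excludes;
  the same holds above the mean.\<close>

lemma AE_eq_expectation_if_zero_one:
  fixes f :: "'a \<Rightarrow> real"
  assumes "prob_space M" and f[measurable]: "integrable M f"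
    and zero_one: "\<And>C. C \<in> sets borel \<Longrightarrow> (AE x in M. f x \<in> C) \<or> (AE x in M. f x \<notin> C)"
  shows "AE x in M. f x = integral\<^sup>L M f"
proof -
  interpret prob_space M by fact
  have "\<not> (AE x in M. f x < expectation f)"
    using expectation_less[OF f, of "expectation f"] by auto
  then have ge: "AE x in M. expectation f \<le> f x"
    using zero_one[of "{..<expectation f}"] by (auto simp: not_less)
  have "\<not> (AE x in M. expectation f < f x)"
    using expectation_less[of "\<lambda>x. - f x" "- expectation f"] f by auto
  then have le: "AE x in M. f x \<le> expectation f"
    using zero_one[of "{expectation f<..}"] by (auto simp: not_less)
  from ge le show ?thesis by eventually_elim simp
qed

text \<open>A set of the filtration at time \<open>t\<close> either contains or misses \<open>[t, \<infinity>)\<close>, since the interval is an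
  atom of \<open>\<B>\<^sub>t\<close>. Null sets turn this into the almost sure dichotomy, which is stable under
  complements and countable unions. For the converse, a set satisfying the dichotomy is
  changed on a null subset of \<open>[t, \<infinity>)\<close> into a set that misses or contains the interval.\<close>

lemma null_completion_borel_filtration_iff:
  assumes sets[simp]: "sets \<eta> = sets borel" and A: "A \<in> sets borel"
  shows "A \<in> null_completion \<eta> (borel_filtration t) \<longleftrightarrow>
    (AE x in \<eta>. t \<le> x \<longrightarrow> x \<in> A) \<or> (AE x in \<eta>. t \<le> x \<longrightarrow> x \<notin> A)"
    (is "?L \<longleftrightarrow> ?R A")
proof
  let ?E = "borel_filtration t \<union> {N. \<exists>N' \<in> null_sets \<eta>. N \<subseteq> N'}"
  assume ?L
  then have "A \<in> sigma_sets UNIV ?E" by (simp add: null_completion_def)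
  then show "?R A"
  proof (induction rule: sigma_sets.induct)
    case (Basic A)
    then consider "A \<subseteq> {..<t}" | "{t..} \<subseteq> A" | N where "N \<in> null_sets \<eta>" "A \<subseteq> N"
      by (auto simp: borel_filtration_def)
    then show ?case
    proof cases
      case 3
      from AE_not_in[OF 3(1)] have "AE x in \<eta>. x \<notin> A" by eventually_elim (use 3 in auto)
      then have "AE x in \<eta>. t \<le> x \<longrightarrow> x \<notin> A" by eventually_elim auto
      then show ?thesis ..
    qed (auto intro!: AE_I2)
  next
    case (Union A)
    show ?case
    proof (cases "\<exists>i. AE x in \<eta>. t \<le> x \<longrightarrow> x \<in> A i")
      case True
      then obtain i where "AE x in \<eta>. t \<le> x \<longrightarrow> x \<in> A i" ..
      then have "AE x in \<eta>. t \<le> x \<longrightarrow> x \<in> (\<Union>i. A i)" by eventually_elim auto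
      then show ?thesis ..
    next
      case False
      with Union have "AE x in \<eta>. t \<le> x \<longrightarrow> x \<notin> A i" for i by blast
      then have "AE x in \<eta>. \<forall>i. t \<le> x \<longrightarrow> x \<notin> A i" by (subst AE_all_countable) blast
      then have "AE x in \<eta>. t \<le> x \<longrightarrow> x \<notin> (\<Union>i. A i)" by eventually_elim auto
      then show ?thesis ..
    qed
  qed auto
next
  have space: "space \<eta> = UNIV" using sets_eq_imp_space_eq[OF sets] by simp
  let ?S = "null_completion \<eta> (borel_filtration t)"
  interpret S: sigma_algebra UNIV ?S
    unfolding null_completion_def by (rule sigma_algebra_sigma_sets) auto
  have null: "N \<in> ?S" if "AE x in \<eta>. x \<notin> N" for N
  proof -
    from that obtain N' where "N' \<in> null_sets \<eta>" "N \<subseteq> N'"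
      by (auto elim!: AE_E2 simp: eventually_ae_filter space)
    then show ?thesis unfolding null_completion_def by (intro sigma_sets.Basic) auto
  qed
  have filt: "B \<in> ?S" if "B \<in> borel_filtration t" for B
    using that unfolding null_completion_def by (intro sigma_sets.Basic) auto
  assume "?R A"
  then show ?L
  proof
    assume "AE x in \<eta>. t \<le> x \<longrightarrow> x \<in> A"
    then have "{t..} - A \<in> ?S" by (intro null) (auto elim!: eventually_mono)
    moreover have "A \<union> {t..} \<in> ?S" using A by (intro filt) (auto simp: borel_filtration_def)
    ultimately have "(A \<union> {t..}) - ({t..} - A) \<in> ?S" by blast
    moreover have "(A \<union> {t..}) - ({t..} - A) = A" by auto
    ultimately show ?L by simp
  next
    assume "AE x in \<eta>. t \<le> x \<longrightarrow> x \<notin> A"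
    then have "A \<inter> {t..} \<in> ?S" by (intro null) (auto elim!: eventually_mono)
    moreover have "A \<inter> {..<t} \<in> ?S" using A by (intro filt) (auto simp: borel_filtration_def)
    ultimately have "(A \<inter> {t..}) \<union> (A \<inter> {..<t}) \<in> ?S" by blast
    moreover have "(A \<inter> {t..}) \<union> (A \<inter> {..<t}) = A" by auto
    ultimately show ?L by simp
  qed
qed

lemma transport_kernel_is_kernel:
  assumes "\<gamma> \<in> transport_plans \<eta> \<nu>"
  shows "is_transport_kernel \<eta> \<gamma> (transport_kernel \<eta> \<gamma>)"
  unfolding transport_kernel_def using transport_kernel_exists[OF assms] by (rule someI_ex)

text \<open>Inclusion of generated \<open>\<sigma>\<close>-fields is tested on generators, and for each generator the
  previous description of the completed filtration applies.\<close>

lemma causal_plans_iff_AE_zero_one: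
  assumes \<gamma>: "\<gamma> \<in> transport_plans \<eta> \<nu>"
  defines "\<phi> \<equiv> \<lambda>B x. measure (transport_kernel \<eta> \<gamma> x) B"
  shows "\<gamma> \<in> causal_plans \<eta> \<nu> \<longleftrightarrow>
    (\<forall>t. \<forall>B\<in>borel_filtration t. measure \<nu> (frontier B) = 0 \<longrightarrow>
      (\<forall>C\<in>sets borel. (AE x in \<eta>. t \<le> x \<longrightarrow> \<phi> B x \<in> C) \<or> (AE x in \<eta>. t \<le> x \<longrightarrow> \<phi> B x \<notin> C)))"
proof -
  have sets: "sets \<eta> = sets borel" using \<gamma> by (auto simp: transport_plans_def)
  have kernel: "is_transport_kernel \<eta> \<gamma> (transport_kernel \<eta> \<gamma>)"
    by (rule transport_kernel_is_kernel[OF \<gamma>])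
  have generators: "plan_filtration \<eta> \<nu> \<gamma> t \<subseteq> null_completion \<eta> (borel_filtration t) \<longleftrightarrow>
      (\<forall>B\<in>borel_filtration t. measure \<nu> (frontier B) = 0 \<longrightarrow>
        (\<forall>C\<in>sets borel. \<phi> B -` C \<in> null_completion \<eta> (borel_filtration t)))"
    (is "?L \<longleftrightarrow> ?R") for t
  proof
    assume L: ?L
    have "\<phi> B -` C \<in> plan_filtration \<eta> \<nu> \<gamma> t"
      if "B \<in> borel_filtration t" "measure \<nu> (frontier B) = 0" "C \<in> sets borel" for B C
      using that unfolding plan_filtration_def null_completion_def \<phi>_def
      by (intro sigma_sets.Basic UnI1) blast
    with L show ?R by blast
  next
    assume R: ?R
    interpret S: sigma_algebra UNIV "null_completion \<eta> (borel_filtration t)"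
      unfolding null_completion_def by (rule sigma_algebra_sigma_sets) auto
    have null: "{N. \<exists>N' \<in> null_sets \<eta>. N \<subseteq> N'} \<subseteq> null_completion \<eta> (borel_filtration t)"
      unfolding null_completion_def by (auto intro!: sigma_sets.Basic)
    show ?L
      unfolding plan_filtration_def
      by (subst null_completion_def, intro S.sigma_sets_subset Un_least null)
        (use R in \<open>unfold \<phi>_def, blast\<close>)
  qed
  have "\<phi> B -` C \<in> sets borel" if "B \<in> borel_filtration t" "C \<in> sets borel" for B C t
  proof -
    have "\<phi> B \<in> borel_measurable borel"
      using kernel that(1) unfolding \<phi>_def is_transport_kernel_def borel_filtration_def by auto
    from measurable_sets[OF this that(2)] show ?thesis by simp
  qed
  then show ?thesis
    using \<gamma> null_completion_borel_filtration_iff[OF sets] unfolding causal_plans_def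
    by (auto simp: generators)
qed

text \<open>By the zero-one property, \<open>x \<mapsto> Q\<^sup>x(B)\<close> is almost surely a constant \<open>c\<close> on \<open>[t, \<infinity>)\<close>.
  Integration over \<open>D\<close> and over the whole interval gives \<open>\<gamma>(D \<times> B) = c \<eta>(D)\<close> and
  \<open>\<gamma>([t, \<infinity>) \<times> B) = c \<eta>([t, \<infinity>))\<close>. Eliminating \<open>c\<close> by cross-multiplication
  instead of division keeps the rule meaningful when \<open>[t, \<infinity>)\<close> is null.\<close>

lemma causal_plans_product_rule_frontier:
  assumes causal: "\<gamma> \<in> causal_plans \<eta> \<nu>" and B: "B \<in> borel_filtration t" "measure \<nu> (frontier B) = 0"
    and D: "D \<in> sets borel" "D \<subseteq> {t..}"
  shows "measure \<gamma> (D \<times> B) * measure \<eta> {t..} = measure \<eta> D * measure \<gamma> ({t..} \<times> B)"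
proof -
  have \<gamma>: "\<gamma> \<in> transport_plans \<eta> \<nu>" using causal by (simp add: causal_plans_def)
  note sets_eta[simp, measurable_cong] = transport_planD(5)[OF \<gamma>]
  note kernel = transport_kernel_is_kernel[OF \<gamma>]
  interpret E: prob_space \<eta> by (rule transport_planD(4)[OF \<gamma>])
  show ?thesis
  proof (cases "measure \<eta> {t..} = 0")
    case True
    have "measure \<eta> D \<le> measure \<eta> {t..}" using D by (intro E.finite_measure_mono) auto
    with True have "measure \<eta> D = 0" by (simp add: measure_le_0_iff)
    with True show ?thesis by simp
  next
    case False
    define f where "f x = measure (transport_kernel \<eta> \<gamma> x) B" for x
    have B'[measurable]: "B \<in> sets borel" using B(1) by (simp add: borel_filtration_def)
    have f_meas[measurable]: "f \<in> borel_measurable borel"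
      and f_int: "\<And>D. D \<in> sets borel \<Longrightarrow> measure \<gamma> (D \<times> B) = (LINT x:D|\<eta>. f x)"
      and f_prob: "\<And>x. prob_space (transport_kernel \<eta> \<gamma> x)"
      using kernel B' unfolding f_def is_transport_kernel_def by (auto simp: space_prob_algebra)
    have f_range: "0 \<le> f x" "f x \<le> 1" for x
      using prob_space.prob_le_1[OF f_prob] by (auto simp: f_def)
    \<comment> \<open>The law of the first coordinate conditioned on \<open>[t, \<infinity>)\<close>.\<close>
    define U where "U = uniform_measure \<eta> {t..}"
    have pos: "emeasure \<eta> {t..} \<noteq> 0" "emeasure \<eta> {t..} < \<infinity>"
      using False by (auto simp: E.emeasure_eq_measure)
    have AE_U: "(AE x in U. R x) \<longleftrightarrow> (AE x in \<eta>. t \<le> x \<longrightarrow> R x)" for R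
      unfolding U_def using AE_uniform_measure[OF pos] by simp
    have "prob_space U" unfolding U_def using pos by (intro prob_space_uniform_measure) auto
    moreover have "integrable U f"
    proof -
      interpret U: prob_space U by fact
      show ?thesis using f_range by (intro U.integrable_const_bound[of _ 1]) (auto simp: U_def)
    qed
    moreover have "(AE x in U. f x \<in> C) \<or> (AE x in U. f x \<notin> C)" if "C \<in> sets borel" for C
      using causal B that unfolding causal_plans_iff_AE_zero_one[OF \<gamma>] AE_U f_def by blast
    ultimately have "AE x in U. f x = integral\<^sup>L U f" by (rule AE_eq_expectation_if_zero_one)
    then obtain c where c: "AE x in \<eta>. t \<le> x \<longrightarrow> f x = c" unfolding AE_U by blast
    have "measure \<gamma> (D \<times> B) = c * measure \<eta> D" if D[measurable]: "D \<in> sets borel" and "D \<subseteq> {t..}" for D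
    proof -
      have "(LINT x:D|\<eta>. f x) = (LINT x:D|\<eta>. c)"
        unfolding set_lebesgue_integral_def
        using c that by (intro integral_cong_AE) (auto split: split_indicator elim!: eventually_mono)
      also have "\<dots> = c * measure \<eta> D"
        by (simp add: set_lebesgue_integral_def E.emeasure_eq_measure)
      finally show ?thesis using f_int[OF D] by simp
    qed
    from this[OF D] this[of "{t..}"] show ?thesis by simp
  qed
qed

text \<open>Causality only speaks about sets with \<open>\<nu>\<close>-null boundary. The measure \<open>\<nu>\<close> has at most countably
  many atoms, so every open half-line below \<open>t\<close> is an increasing union of closed half-lines whose
  endpoints are not atoms, and the open half-lines generate the Borel sets. Both sides are
  measures in \<open>A\<close>.\<close>

lemma causal_plans_product_rule:
  assumes causal: "\<gamma> \<in> causal_plans \<eta> \<nu>"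
    and A: "A \<in> sets borel" "A \<subseteq> {..<t}" and D: "D \<in> sets borel" "D \<subseteq> {t..}"
  shows "measure \<gamma> (D \<times> A) * measure \<eta> {t..} = measure \<eta> D * measure \<gamma> ({t..} \<times> A)"
proof -
  have \<gamma>: "\<gamma> \<in> transport_plans \<eta> \<nu>" using causal by (simp add: causal_plans_def)
  interpret G: prob_space \<gamma> by (rule transport_planD(1)[OF \<gamma>])
  interpret N: prob_space \<nu> by (rule transport_planD(6)[OF \<gamma>])
  note rect = transport_planD(8)[OF \<gamma>]
  let ?P = "\<lambda>S. measure \<gamma> (D \<times> (S \<inter> {..<t})) * measure \<eta> {t..}
    = measure \<eta> D * measure \<gamma> ({t..} \<times> (S \<inter> {..<t}))"
  have half_line: "measure \<gamma> (D \<times> {..<a}) * measure \<eta> {t..} = measure \<eta> D * measure \<gamma> ({t..} \<times> {..<a})"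
    if "a \<le> t" for a
  proof -
    \<comment> \<open>Choosing the \<open>n\<close>-th endpoint strictly between consecutive terms of \<open>l\<close> makes the endpoints increase
      to \<open>a\<close>.\<close>
    define l where "l n = a - 1 / real (Suc n)" for n
    have l_less: "l n < l (Suc n)" for n unfolding l_def by (simp add: field_simps)
    have "\<exists>b. l n < b \<and> b < l (Suc n) \<and> measure \<nu> {b} = 0" for n
    proof -
      have "uncountable ({l n<..<l (Suc n)} - {b. measure \<nu> {b} \<noteq> 0})"
        using l_less[of n] N.countable_support by (intro uncountable_minus_countable) (simp_all add: uncountable_open_interval)
      then have "{l n<..<l (Suc n)} - {b. measure \<nu> {b} \<noteq> 0} \<noteq> {}"
        by (metis countable_empty)
      then show ?thesis by auto
    qed
    then obtain b where b: "\<And>n. l n < b n" "\<And>n. b n < l (Suc n)" "\<And>n. measure \<nu> {b n} = 0" by metis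
    have "incseq b" using b(1,2) by (intro incseq_SucI) (meson less_trans less_imp_le)
    have b_less: "b n < a" for n
    proof -
      have "l (Suc n) < a" by (simp add: l_def)
      with b(2)[of n] show ?thesis by simp
    qed
    have "l \<longlonglongrightarrow> a"
      unfolding l_def using tendsto_diff[OF tendsto_const LIMSEQ_inverse_real_of_nat, of a]
      by (simp add: inverse_eq_divide)
    have Un: "(\<Union>n. {..b n}) = {..<a}"
    proof (intro equalityI subsetI)
      fix y assume "y \<in> {..<a}"
      with order_tendstoD(1)[OF \<open>l \<longlonglongrightarrow> a\<close>, of y] obtain n where "y < l n"
        by (auto simp: eventually_sequentially)
      with b(1)[of n] show "y \<in> (\<Union>n. {..b n})" by (auto intro!: exI[of _ n])
    qed (use b_less in \<open>auto intro: le_less_trans\<close>)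
    have lim: "(\<lambda>n. measure \<gamma> (S \<times> {..b n})) \<longlonglongrightarrow> measure \<gamma> (S \<times> {..<a})" if "S \<in> sets borel" for S
    proof -
      have "(\<lambda>n. measure \<gamma> (S \<times> {..b n})) \<longlonglongrightarrow> measure \<gamma> (\<Union>n. S \<times> {..b n})"
        using \<open>incseq b\<close> that by (intro G.finite_Lim_measure_incseq) (auto simp: incseq_def intro!: rect intro: order_trans)
      also have "(\<Union>n. S \<times> {..b n}) = S \<times> {..<a}" using Un by auto
      finally show ?thesis .
    qed
    have eq: "measure \<gamma> (D \<times> {..b n}) * measure \<eta> {t..} = measure \<eta> D * measure \<gamma> ({t..} \<times> {..b n})" for n
    proof (rule causal_plans_product_rule_frontier[OF causal _ _ D])
      show "{..b n} \<in> borel_filtration t" using b_less[of n] \<open>a \<le> t\<close> by (auto simp: borel_filtration_def)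
      have "frontier {..b n} = {b n}" by (auto simp: frontier_def)
      with b(3) show "measure \<nu> (frontier {..b n}) = 0" by simp
    qed
    have "(\<lambda>n. measure \<gamma> (D \<times> {..b n}) * measure \<eta> {t..}) \<longlonglongrightarrow> measure \<gamma> (D \<times> {..<a}) * measure \<eta> {t..}"
      by (intro tendsto_mult_right lim D)
    moreover have "(\<lambda>n. measure \<gamma> (D \<times> {..b n}) * measure \<eta> {t..}) \<longlonglongrightarrow> measure \<eta> D * measure \<gamma> ({t..} \<times> {..<a})"
      unfolding eq by (intro tendsto_mult_left lim) simp
    ultimately show ?thesis by (rule LIMSEQ_unique)
  qed
  have "{..<a} \<inter> {..<b} = {..<min a b}" for a b :: real by auto
  then have "Int_stable (range (\<lambda>a::real. {..<a}))" "range (\<lambda>a::real. {..<a}) \<subseteq> Pow UNIV"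
    by (auto simp: Int_stable_def)
  moreover have "A \<in> sigma_sets UNIV (range (\<lambda>a::real. {..<a}))"
    using A(1) by (subst (asm) borel_Iio) simp
  ultimately have "?P A"
  proof (induction rule: sigma_sets_induct_disjoint)
    case (basic S)
    then obtain a where "S = {..<a}" by auto
    \<comment> \<open>Cutting at \<open>t\<close> turns any open half-line into one that ends at or below \<open>t\<close>.\<close>
    then have "S \<inter> {..<t} = {..<min a t}" by auto
    then show ?case using half_line[of "min a t"] by simp
  next
    case empty then show ?case by simp
  next
    case (compl S)
    then have "S \<in> sets borel" by (subst borel_Iio) simp
    have "measure \<gamma> (R \<times> ((UNIV - S) \<inter> {..<t})) = measure \<gamma> (R \<times> {..<t}) - measure \<gamma> (R \<times> (S \<inter> {..<t}))"
      if "R \<in> sets borel" for R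
    proof -
      have "R \<times> ((UNIV - S) \<inter> {..<t}) = R \<times> {..<t} - R \<times> (S \<inter> {..<t})" by auto
      with \<open>S \<in> sets borel\<close> that show ?thesis
        by (simp only:) (intro G.finite_measure_Diff, auto intro!: rect)
    qed
    from this[OF D(1)] this[of "{t..}"] show ?case
      using compl(2) half_line[of t] by (simp add: left_diff_distrib right_diff_distrib)
  next
    case (union S)
    then have "S i \<in> sets borel" for i by (subst borel_Iio) (auto simp: image_subset_iff)
    then have sums: "(\<lambda>i. measure \<gamma> (R \<times> (S i \<inter> {..<t}))) sums measure \<gamma> (R \<times> ((\<Union>i. S i) \<inter> {..<t}))"
      if "R \<in> sets borel" for R
    proof -
      have "R \<times> ((\<Union>i. S i) \<inter> {..<t}) = (\<Union>i. R \<times> (S i \<inter> {..<t}))" by auto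
      then show ?thesis
        using union(1) that \<open>\<And>i. S i \<in> sets borel\<close>
        by (simp only:) (intro G.finite_measure_UNION, auto intro!: rect simp: disjoint_family_on_def)
    qed
    have "(\<lambda>i. measure \<gamma> (D \<times> (S i \<inter> {..<t})) * measure \<eta> {t..}) sums
        (measure \<gamma> (D \<times> ((\<Union>i. S i) \<inter> {..<t})) * measure \<eta> {t..})"
      by (intro sums_mult2 sums D)
    moreover have "(\<lambda>i. measure \<gamma> (D \<times> (S i \<inter> {..<t})) * measure \<eta> {t..}) sums
        (measure \<eta> D * measure \<gamma> ({t..} \<times> ((\<Union>i. S i) \<inter> {..<t})))"
      unfolding union(3) by (intro sums_mult sums) simp
    ultimately show ?case by (rule sums_unique2)
  qed
  moreover have "A \<inter> {..<t} = A" using A(2) by auto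
  ultimately show ?thesis by simp
qed

text \<open>For a set below \<open>t\<close> the product rule says that the kernel and the constant
  \<open>\<gamma>([t, \<infinity>) \<times> A) / \<eta>([t, \<infinity>))\<close> have the same integrals over all Borel subsets of \<open>[t, \<infinity>)\<close>,
  so they agree there almost surely. A set of \<open>\<B>\<^sub>t\<close> that contains \<open>[t, \<infinity>)\<close> is the complement of
  such a set, and kernels consist of probability measures.\<close>

lemma causal_plansI_product_rule:
  assumes \<gamma>: "\<gamma> \<in> transport_plans \<eta> \<nu>"
    and product: "\<And>t A D. A \<in> sets borel \<Longrightarrow> A \<subseteq> {..<t} \<Longrightarrow> D \<in> sets borel \<Longrightarrow> D \<subseteq> {t..} \<Longrightarrow>
      measure \<gamma> (D \<times> A) * measure \<eta> {t..} = measure \<eta> D * measure \<gamma> ({t..} \<times> A)"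
  shows "\<gamma> \<in> causal_plans \<eta> \<nu>"
proof -
  interpret E: prob_space \<eta> by (rule transport_planD(4)[OF \<gamma>])
  note sets_eta[simp, measurable_cong] = transport_planD(5)[OF \<gamma>]
  note kernel = transport_kernel_is_kernel[OF \<gamma>]
  define \<phi> where "\<phi> B x = measure (transport_kernel \<eta> \<gamma> x) B" for B x
  have below: "\<exists>c. AE x in \<eta>. t \<le> x \<longrightarrow> \<phi> A x = c" if A: "A \<in> sets borel" "A \<subseteq> {..<t}" for A t
  proof -
    define c where "c = measure \<gamma> ({t..} \<times> A) / measure \<eta> {t..}"
    have [measurable]: "\<phi> A \<in> borel_measurable borel"
      and f_int: "\<And>D. D \<in> sets borel \<Longrightarrow> measure \<gamma> (D \<times> A) = (LINT x:D|\<eta>. \<phi> A x)"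
      and f_prob: "\<And>x. prob_space (transport_kernel \<eta> \<gamma> x)"
      using kernel A unfolding \<phi>_def is_transport_kernel_def by (auto simp: space_prob_algebra)
    have f_range: "0 \<le> \<phi> A x" "\<phi> A x \<le> 1" for x
      using prob_space.prob_le_1[OF f_prob] by (auto simp: \<phi>_def)
    have eq: "(LINT x:D|\<eta>. \<phi> A x) = c * measure \<eta> D" if D: "D \<in> sets borel" "D \<subseteq> {t..}" for D
    proof (cases "measure \<eta> {t..} = 0")
      case True
      have "measure \<eta> D \<le> measure \<eta> {t..}" using D by (intro E.finite_measure_mono) auto
      with True have "emeasure \<eta> D = 0" by (simp add: measure_le_0_iff E.emeasure_eq_measure)
      then have "D \<in> null_sets \<eta>" using D by auto
      from AE_not_in[OF this] have "(LINT x:D|\<eta>. \<phi> A x) = 0"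
        unfolding set_lebesgue_integral_def
        by (intro integral_eq_zero_AE) (auto elim!: eventually_mono)
      with \<open>emeasure \<eta> D = 0\<close> show ?thesis by (simp add: measure_def)
    next
      case False
      then show ?thesis using product[OF A D] f_int[OF D(1)] by (simp add: c_def field_simps)
    qed
    have "AE x in \<eta>. indicator {t..} x * \<phi> A x = indicator {t..} x * c"
    proof (rule density_unique_real)
      show "integrable \<eta> (\<lambda>x. indicator {t..} x * \<phi> A x)"
        using f_range by (intro E.integrable_const_bound[of _ 1]) (auto split: split_indicator)
      show "integrable \<eta> (\<lambda>x. indicator {t..} x * c)"
        by (intro E.integrable_const_bound[of _ "\<bar>c\<bar>"]) (auto split: split_indicator)
      show "(LINT x:S|\<eta>. indicator {t..} x * \<phi> A x) = (LINT x:S|\<eta>. indicator {t..} x * c)" if "S \<in> sets \<eta>" for S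
      proof -
        have *: "(LINT x:S|\<eta>. indicator {t..} x * h x) = (LINT x:S \<inter> {t..}|\<eta>. h x)" for h :: "real \<Rightarrow> real"
          unfolding set_lebesgue_integral_def
          by (intro Bochner_Integration.integral_cong) (auto split: split_indicator)
        have "S \<inter> {t..} \<in> sets borel" using that by auto
        then show ?thesis
          using eq[of "S \<inter> {t..}"] unfolding *
          by (simp add: set_lebesgue_integral_def)
      qed
    qed
    then have "AE x in \<eta>. t \<le> x \<longrightarrow> \<phi> A x = c"
      by eventually_elim auto
    then show ?thesis ..
  qed
  have const: "\<exists>c. AE x in \<eta>. t \<le> x \<longrightarrow> \<phi> B x = c" if B: "B \<in> borel_filtration t" for B t
  proof (cases "B \<subseteq> {..<t}")
    case True then show ?thesis using below B by (auto simp: borel_filtration_def)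
  next
    case False
    with B have [measurable]: "B \<in> sets borel" and "{t..} \<subseteq> B"
      by (auto simp: borel_filtration_def)
    then have "UNIV - B \<in> sets borel" "UNIV - B \<subseteq> {..<t}" by (auto simp: not_le[symmetric])
    from below[OF this(1,2)] obtain c where c: "AE x in \<eta>. t \<le> x \<longrightarrow> \<phi> (UNIV - B) x = c" ..
    have "\<phi> B x = 1 - \<phi> (UNIV - B) x" for x
    proof -
      have Q: "prob_space (transport_kernel \<eta> \<gamma> x)" "sets (transport_kernel \<eta> \<gamma> x) = sets borel"
        using kernel by (auto simp: is_transport_kernel_def space_prob_algebra)
      show ?thesis
        using prob_space.prob_compl[OF Q(1), of B] sets_eq_imp_space_eq[OF Q(2)] Q(2) by (simp add: \<phi>_def)
    qed
    with c have "AE x in \<eta>. t \<le> x \<longrightarrow> \<phi> B x = 1 - c" by simp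
    then show ?thesis ..
  qed
  show ?thesis
    unfolding causal_plans_iff_AE_zero_one[OF \<gamma>] \<phi>_def[symmetric]
  proof (intro allI ballI impI)
    fix t B and C :: "real set" assume "B \<in> borel_filtration t"
    from const[OF this] obtain c where c: "AE x in \<eta>. t \<le> x \<longrightarrow> \<phi> B x = c" ..
    show "(AE x in \<eta>. t \<le> x \<longrightarrow> \<phi> B x \<in> C) \<or> (AE x in \<eta>. t \<le> x \<longrightarrow> \<phi> B x \<notin> C)"
    proof (cases "c \<in> C")
      case True with c show ?thesis by (intro disjI1) (auto elim!: eventually_mono)
    next
      case False with c show ?thesis by (intro disjI2) (auto elim!: eventually_mono)
    qed
  qed
qed

section \<open>Causal plans and adapted couplings\<close>

text \<open>The coordinates on the plane become an adapted coupling with \<open>\<tau> = min X Y\<close> and \<open>Z = max 0 (Y - X)\<close>: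
  if \<open>X \<le> Y\<close> then \<open>X \<le> \<tau>\<close> and \<open>X + Z = Y\<close>, and otherwise \<open>\<tau> = Y < X\<close>. Where \<open>X \<ge> t\<close>, the value
  of \<open>\<tau>\<close> is below \<open>t\<close> exactly when that of \<open>Y\<close> is, and then the two coincide, so the conditional
  independence of \<open>\<tau>\<close> and \<open>X\<close> is the product rule of the plan.\<close>

lemma adapted_coupling_completion_of_causal_plan:
  assumes causal: "\<gamma> \<in> causal_plans \<eta> \<nu>"
  shows "(fst, snd, completion \<gamma>) \<in> Cpl_a \<eta> \<nu>"
    and "distr (completion \<gamma>) borel (\<lambda>\<omega>. (fst \<omega>, snd \<omega>)) = \<gamma>"
proof -
  have \<gamma>: "\<gamma> \<in> transport_plans \<eta> \<nu>" using causal by (simp add: causal_plans_def)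
  note plan = transport_planD[OF \<gamma>]
  note [measurable_cong] = plan(2) and rect = plan(8)
  interpret G: prob_space \<gamma> by (rule plan(1))
  have sets_G: "sets \<gamma> = sets borel" unfolding plan(2) borel_prod ..
  have [measurable]: "fst \<in> \<gamma> \<rightarrow>\<^sub>M borel" "snd \<in> \<gamma> \<rightarrow>\<^sub>M borel"
    by measurable
  have [measurable]: "(\<lambda>\<omega>. \<omega>) \<in> \<gamma> \<rightarrow>\<^sub>M borel"
    unfolding borel_prod[symmetric] by measurable
  let ?\<tau> = "\<lambda>\<omega>::real \<times> real. min (fst \<omega>) (snd \<omega>)" and ?Z = "\<lambda>\<omega>::real \<times> real. max 0 (snd \<omega> - fst \<omega>)"
  have "\<P>(\<omega> in completion \<gamma>. ?\<tau> \<omega> \<in> A \<and> fst \<omega> \<in> B \<bar> fst \<omega> \<ge> t) =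
      \<P>(\<omega> in completion \<gamma>. ?\<tau> \<omega> \<in> A \<bar> fst \<omega> \<ge> t) * \<P>(\<omega> in completion \<gamma>. fst \<omega> \<in> B \<bar> fst \<omega> \<ge> t)"
    if pos: "\<P>(\<omega> in completion \<gamma>. fst \<omega> \<ge> t) > 0"
      and A: "A \<in> sets borel" "A \<subseteq> {..<t}" and B: "B \<in> sets borel" "B \<subseteq> {t..}" for t A B
  proof -
    have events: "{\<omega> \<in> space (completion \<gamma>). fst \<omega> \<ge> t} = {t..} \<times> UNIV"
      "{\<omega> \<in> space (completion \<gamma>). fst \<omega> \<in> B \<and> fst \<omega> \<ge> t} = B \<times> UNIV"
      "{\<omega> \<in> space (completion \<gamma>). (?\<tau> \<omega> \<in> A \<and> fst \<omega> \<in> B) \<and> fst \<omega> \<ge> t} = B \<times> A"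
      "{\<omega> \<in> space (completion \<gamma>). ?\<tau> \<omega> \<in> A \<and> fst \<omega> \<ge> t} = {t..} \<times> A"
      using A(2) B(2) by (force simp: plan(3) min_def split: if_splits)+
    have "measure \<eta> {t..} > 0"
      using pos unfolding events by (simp add: rect measure_Times_UNIV_eq_marginal[OF \<gamma>])
    then show ?thesis
      unfolding cond_prob_def events
      using causal_plans_product_rule[OF causal A B] A B
      by (simp add: rect measure_Times_UNIV_eq_marginal[OF \<gamma>] field_simps)
  qed
  then have "adapted_coupling (completion \<gamma>) fst snd"
    unfolding adapted_coupling_def
    by (intro conjI bexI[of _ ?\<tau>] bexI[of _ ?Z] allI ballI impI AE_I2 G.prob_space_completion
        completion.complete_measure_axioms measurable_completion) (auto simp: min_def split: split_indicator)
  then show "(fst, snd, completion \<gamma>) \<in> Cpl_a \<eta> \<nu>"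
    using \<gamma> by (simp add: Cpl_a_def distr_completion transport_plans_def)
  show "distr (completion \<gamma>) borel (\<lambda>\<omega>. (fst \<omega>, snd \<omega>)) = \<gamma>"
    using distr_id2[OF sets_G[symmetric]] by (simp add: distr_completion)
qed

text \<open>Where \<open>X \<ge> t\<close>, almost surely \<open>Y\<close> takes a value in a set \<open>A\<close> below \<open>t\<close> if and only if \<open>\<tau>\<close> does: a
  value \<open>Y < t \<le> X\<close> is impossible when \<open>X \<le> \<tau>\<close>, as then \<open>Y = X + Z \<ge> X\<close>, and in the other
  case \<open>Y = \<tau>\<close>. Hence the conditional independence of \<open>\<tau>\<close> and \<open>X\<close> is the product rule for the
  joint law.\<close>

lemma causal_plan_of_adapted_coupling:
  fixes X Y :: "'a \<Rightarrow> real"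
  assumes "adapted_coupling P X Y"
  shows "distr P borel (\<lambda>\<omega>. (X \<omega>, Y \<omega>)) \<in> causal_plans (distr P borel X) (distr P borel Y)"
proof -
  from assms obtain \<tau> Z where "prob_space P"
    and [measurable]: "X \<in> borel_measurable P" "Y \<in> borel_measurable P"
      "\<tau> \<in> borel_measurable P" "Z \<in> borel_measurable P"
    and Y: "AE \<omega> in P. Y \<omega> = (X \<omega> + Z \<omega>) * indicator {\<omega>. X \<omega> \<le> \<tau> \<omega>} \<omega>
                          + \<tau> \<omega> * indicator {\<omega>. X \<omega> > \<tau> \<omega>} \<omega>"
    and Z: "AE \<omega> in P. Z \<omega> \<ge> 0"
    and indep: "\<forall>t. \<P>(\<omega> in P. X \<omega> \<ge> t) > 0 \<longrightarrow>
      (\<forall>A \<in> sets borel. \<forall>B \<in> sets borel. A \<subseteq> {..<t} \<longrightarrow> B \<subseteq> {t..} \<longrightarrow>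
        \<P>(\<omega> in P. \<tau> \<omega> \<in> A \<and> X \<omega> \<in> B \<bar> X \<omega> \<ge> t) =
        \<P>(\<omega> in P. \<tau> \<omega> \<in> A \<bar> X \<omega> \<ge> t) * \<P>(\<omega> in P. X \<omega> \<in> B \<bar> X \<omega> \<ge> t))"
    unfolding adapted_coupling_def by (elim conjE bexE) (rule that)
  interpret prob_space P by fact
  define \<gamma> where "\<gamma> = distr P borel (\<lambda>\<omega>. (X \<omega>, Y \<omega>))"
  define \<eta> where "\<eta> = distr P borel X"
  have pair[measurable]: "(\<lambda>\<omega>. (X \<omega>, Y \<omega>)) \<in> P \<rightarrow>\<^sub>M borel"
    unfolding borel_prod[symmetric] by measurable
  have [measurable]: "(fst :: real \<times> real \<Rightarrow> real) \<in> borel \<rightarrow>\<^sub>M borel"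
      "(snd :: real \<times> real \<Rightarrow> real) \<in> borel \<rightarrow>\<^sub>M borel"
    unfolding borel_prod[symmetric] by measurable
  have \<gamma>: "\<gamma> \<in> transport_plans \<eta> (distr P borel Y)"
    unfolding transport_plans_def \<gamma>_def \<eta>_def
    by (auto simp: space_prob_algebra distr_distr comp_def intro!: prob_space_distr)
  have "\<gamma> \<in> causal_plans \<eta> (distr P borel Y)"
  proof (rule causal_plansI_product_rule[OF \<gamma>])
    fix t :: real and A D :: "real set" assume A[measurable]: "A \<in> sets borel" and "A \<subseteq> {..<t}"
      and D[measurable]: "D \<in> sets borel" and "D \<subseteq> {t..}"
    have \<eta>: "measure \<eta> S = \<P>(\<omega> in P. X \<omega> \<in> S \<and> X \<omega> \<ge> t)" if "S \<in> sets borel" "S \<subseteq> {t..}" for S :: "real set"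
      unfolding \<eta>_def using that by (subst measure_distr) (auto intro!: arg_cong[where f=prob])
    have \<gamma>_\<tau>: "measure \<gamma> (S \<times> A) = \<P>(\<omega> in P. (\<tau> \<omega> \<in> A \<and> X \<omega> \<in> S) \<and> X \<omega> \<ge> t)"
      if S[measurable]: "S \<in> sets borel" and "S \<subseteq> {t..}" for S
    proof -
      have "S \<times> A \<in> sets borel" unfolding borel_prod[symmetric] by measurable
      then have "measure \<gamma> (S \<times> A) = \<P>(\<omega> in P. X \<omega> \<in> S \<and> Y \<omega> \<in> A)"
        unfolding \<gamma>_def by (subst measure_distr) (auto intro!: arg_cong[where f=prob])
      also have "\<dots> = \<P>(\<omega> in P. (\<tau> \<omega> \<in> A \<and> X \<omega> \<in> S) \<and> X \<omega> \<ge> t)"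
      proof (rule finite_measure_eq_AE)
        show "AE \<omega> in P. \<omega> \<in> {\<omega> \<in> space P. X \<omega> \<in> S \<and> Y \<omega> \<in> A} \<longleftrightarrow>
            \<omega> \<in> {\<omega> \<in> space P. (\<tau> \<omega> \<in> A \<and> X \<omega> \<in> S) \<and> X \<omega> \<ge> t}"
          using Y Z
        proof eventually_elim
          case (elim \<omega>)
          have "a \<in> A \<Longrightarrow> a < t" for a using \<open>A \<subseteq> {..<t}\<close> by auto
          moreover have "a \<in> S \<Longrightarrow> t \<le> a" for a using \<open>S \<subseteq> {t..}\<close> by auto
          ultimately show ?case using elim
            by (cases "X \<omega> \<le> \<tau> \<omega>") (force simp: not_le[symmetric])+
        qed
      qed measurable
      finally show ?thesis .
    qed
    show "measure \<gamma> (D \<times> A) * measure \<eta> {t..} = measure \<eta> D * measure \<gamma> ({t..} \<times> A)"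
    proof (cases "\<P>(\<omega> in P. X \<omega> \<ge> t) = 0")
      case True
      have "\<P>(\<omega> in P. X \<omega> \<in> D \<and> X \<omega> \<ge> t) \<le> \<P>(\<omega> in P. X \<omega> \<ge> t)"
        by (intro finite_measure_mono) auto
      with True \<open>D \<subseteq> {t..}\<close> have "measure \<eta> D = 0" by (simp add: \<eta> measure_le_0_iff)
      with True show ?thesis by (simp add: \<eta>)
    next
      case False
      then have "\<P>(\<omega> in P. X \<omega> \<ge> t) > 0" by (simp add: zero_less_measure_iff)
      from indep[rule_format, OF this A D \<open>A \<subseteq> {..<t}\<close> \<open>D \<subseteq> {t..}\<close>] False \<open>D \<subseteq> {t..}\<close> show ?thesis
        unfolding cond_prob_def by (simp add: \<eta> \<gamma>_\<tau> field_simps)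
    qed
  qed
  then show ?thesis by (simp add: \<gamma>_def \<eta>_def)
qed

theorem theorem4p1:
  shows "(\<forall>\<eta> \<in> M1. \<forall>\<nu> \<in> M1. \<forall>\<gamma> \<in> causal_plans \<eta> \<nu>.
            \<exists>(X :: real \<times> real \<Rightarrow> real) Y P.
              (X, Y, P) \<in> Cpl_a \<eta> \<nu> \<and> distr P borel (\<lambda>\<omega>. (X \<omega>, Y \<omega>)) = \<gamma>) \<and>
         (\<forall>(X :: 'a \<Rightarrow> real) Y P.
            (X, Y, P) \<in> Cpl_a (distr P borel X) (distr P borel Y) \<longrightarrow>
              distr P borel (\<lambda>\<omega>. (X \<omega>, Y \<omega>)) \<in> causal_plans (distr P borel X) (distr P borel Y))"
proof (intro conjI ballI allI impI)
  fix \<eta> \<nu> \<gamma> assume "\<gamma> \<in> causal_plans \<eta> \<nu>"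
  from adapted_coupling_completion_of_causal_plan[OF this]
  show "\<exists>(X :: real \<times> real \<Rightarrow> real) Y P.
      (X, Y, P) \<in> Cpl_a \<eta> \<nu> \<and> distr P borel (\<lambda>\<omega>. (X \<omega>, Y \<omega>)) = \<gamma>"
    by (intro exI conjI)
next
  fix X Y :: "'a \<Rightarrow> real" and P
  assume "(X, Y, P) \<in> Cpl_a (distr P borel X) (distr P borel Y)"
  then show "distr P borel (\<lambda>\<omega>. (X \<omega>, Y \<omega>)) \<in> causal_plans (distr P borel X) (distr P borel Y)"
    by (intro causal_plan_of_adapted_coupling) (simp add: Cpl_a_def)
qed

end
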